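(* If $G$ is a randomly $3$-dimensional graph, then $G$ is $3$-regular.
   Context: All graphs are finite, simple and connected. For an ordered set $W=\{w_1,\dots,w_k\}\subseteq V(G)$ and $v\in V(G)$, $r(v|W)=(d(v,w_1),\dots,d(v,w_k))$, where $d$ denotes graph distance. $W$ is a resolving set if distinct vertices have distinct representations with respect to $W$; a basis is a minimum-size resolving set and its size is the metric dimension $\beta(G)$. $G$ is randomly $k$-dimensional if $\beta(G)=k$ and every $k$-subset of $V(G)$ is a basis of $G$. *)

theory Defs
  imports "Graph_Theory.Graph_Theory" "HOL-Library.FuncSet"
begin

text \<open>Meaningful for endpoints joined by a walk; otherwise the value is unspecified.\<close>

definition graph_dist :: "('a, 'b) pre_digraph \<Rightarrow> 'a \<Rightarrow> 'a \<Rightarrow> nat" where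
  "graph_dist G u v = (LEAST n. \<exists>p. pre_digraph.awalk G u p v \<and> length p = n)"

text \<open>The representation $r(v|W)$ is the tuple of distances indexed by $W$ itself, so that no
  ordering of $W$ has to be chosen; \<open>metric_rep_eq_iff_list\<close> below recovers the reading
  with an ordered set.\<close>

definition metric_rep :: "('a, 'b) pre_digraph \<Rightarrow> 'a set \<Rightarrow> 'a \<Rightarrow> 'a \<Rightarrow> nat" where
  "metric_rep G W v = (\<lambda>w\<in>W. graph_dist G v w)"

lemma metric_rep_eq_iff_list:
  "metric_rep G (set ws) u = metric_rep G (set ws) v \<longleftrightarrow>
    map (graph_dist G u) ws = map (graph_dist G v) ws"
  unfolding metric_rep_def by (auto simp: restrict_def fun_eq_iff)

definition resolving_set :: "('a, 'b) pre_digraph \<Rightarrow> 'a set \<Rightarrow> bool" where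
  "resolving_set G W \<longleftrightarrow> W \<subseteq> verts G \<and> inj_on (metric_rep G W) (verts G)"

definition metric_basis :: "('a, 'b) pre_digraph \<Rightarrow> 'a set \<Rightarrow> bool" where
  "metric_basis G W \<longleftrightarrow> resolving_set G W \<and> (\<forall>W'. resolving_set G W' \<longrightarrow> card W \<le> card W')"

definition metric_dim :: "('a, 'b) pre_digraph \<Rightarrow> nat" where
  "metric_dim G = (LEAST k. \<exists>W. resolving_set G W \<and> card W = k)"

definition randomly_dimensional :: "nat \<Rightarrow> ('a, 'b) pre_digraph \<Rightarrow> bool" where
  "randomly_dimensional k G \<longleftrightarrow>
    metric_dim G = k \<and> (\<forall>W. W \<subseteq> verts G \<and> card W = k \<longrightarrow> metric_basis G W)"

text \<open>In a symmetric digraph without multiple arcs, the arcs leaving a vertex correspond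
  one-to-one to its incident undirected edges, so \<open>out_degree\<close> is the usual degree.\<close>

definition regular_graph :: "nat \<Rightarrow> ('a, 'b) pre_digraph \<Rightarrow> bool" where
  "regular_graph k G \<longleftrightarrow> (\<forall>v \<in> verts G. out_degree G v = k)"

end

theory Submission
  imports Defs "HOL-Library.Ramsey"
begin

text \<open>
  Let \<open>n\<close> be the order of \<open>G\<close> and \<open>E(x, y)\<close> the set of vertices equidistant from \<open>x\<close> and \<open>y\<close>.
  Every 3-set resolves, so \<open>E(x, y)\<close> has at most two elements; no 2-set resolves, so every pair of
  vertices is contained in some \<open>E(x, y)\<close>. As there are equally many pairs on both sides, \<open>E\<close> is a
  bijection on the set of pairs. In particular exactly \<open>n - 1\<close> pairs are equidistant from a given
  vertex.

  The distances from a vertex \<open>z\<close> to the closed neighbourhood of \<open>w\<close> take at most three values, so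
  every set of \<open>m\<close> vertices of that neighbourhood contains at least \<open>m - 3\<close> pairs equidistant
  from \<open>z\<close>. Summing over \<open>z \<noteq> w\<close> for the \<open>m\<close> neighbours of \<open>w\<close> gives
  \<open>(n - 1)(m - 3) \<le> m(m - 1)/2\<close>, while \<open>m(m - 1)/2 \<le> n - 1\<close> because the pairs of neighbours are
  equidistant from \<open>w\<close>. So \<open>m \<ge> 4\<close> forces \<open>m = 4\<close> and \<open>n = 7\<close>, no two non-neighbours of \<open>w\<close> have the
  same distance from \<open>w\<close>, and a vertex farthest from \<open>w\<close> is a leaf. But no vertex is equidistant
  from a leaf and its neighbour. For \<open>m = 3\<close>, counting in the closed neighbourhood yields \<open>n \<le> 10\<close>.

  If \<open>w\<close> has just two neighbours \<open>a\<close>, \<open>b\<close>, then, as the spheres around \<open>w\<close> do not grow from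
  radius 2 on, the \<open>n - 1\<close> equidistant pairs force the second sphere to have four elements, two
  adjacent to \<open>a\<close> and two adjacent to \<open>b\<close>. Hence \<open>a\<close> has degree 3 and \<open>n \<le> 10\<close>. Each of \<open>E(w, a)\<close>,
  \<open>E(w, b)\<close>, \<open>E(a, b)\<close> contains a vertex beyond the second sphere. These are three distinct vertices,
  so \<open>n = 10\<close>, and exactly \<open>9 - 1 - 6 = 2\<close> of the three pairs among them are equidistant from \<open>w\<close>,
  which contradicts transitivity.
\<close>

section \<open>Pairs on which a function is constant\<close>

definition tied_pairs :: "('a \<Rightarrow> 'b) \<Rightarrow> 'a set \<Rightarrow> 'a set set" where
  "tied_pairs f A = {B \<in> [A]\<^bsup>2\<^esup>. \<forall>x\<in>B. \<forall>y\<in>B. f x = f y}"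

lemma doubleton_in_tied_pairs [simp]:
  "{x, y} \<in> tied_pairs f A \<longleftrightarrow> x \<in> A \<and> y \<in> A \<and> x \<noteq> y \<and> f x = f y"
  by (auto simp: tied_pairs_def)

lemma tied_pairs_E:
  assumes "B \<in> tied_pairs f A"
  obtains x y where "B = {x, y}" "x \<in> A" "y \<in> A" "x \<noteq> y" "f x = f y"
  using assms by (auto simp: tied_pairs_def elim!: nsets2_E)

lemma finite_tied_pairs: "finite A \<Longrightarrow> finite (tied_pairs f A)"
  by (simp add: tied_pairs_def finite_imp_finite_nsets)

lemma tied_pairs_mono: "A \<subseteq> B \<Longrightarrow> tied_pairs f A \<subseteq> tied_pairs f B"
  using nsets_mono[of A B 2] by (auto simp: tied_pairs_def)

lemma tied_pairs_eq_nsets: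
  "(\<And>x y. \<lbrakk>x \<in> A; y \<in> A\<rbrakk> \<Longrightarrow> f x = f y) \<Longrightarrow> tied_pairs f A = [A]\<^bsup>2\<^esup>"
  by (fastforce simp: tied_pairs_def nsets_def)

lemma card_tied_pairs_Un:
  assumes fin: "finite A" "finite B" and disj: "f ` A \<inter> f ` B = {}"
  shows "card (tied_pairs f (A \<union> B)) = card (tied_pairs f A) + card (tied_pairs f B)"
proof -
  have "tied_pairs f (A \<union> B) = tied_pairs f A \<union> tied_pairs f B"
    using disj by (fastforce elim!: tied_pairs_E)
  moreover have "tied_pairs f A \<inter> tied_pairs f B = {}"
    using disj by (force simp: doubleton_eq_iff elim!: tied_pairs_E)
  ultimately show ?thesis
    using fin by (simp add: card_Un_disjoint finite_tied_pairs)
qed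

lemma card_tied_pairs_containing:
  assumes "finite A" and "x \<in> A"
  shows "Suc (card {B \<in> tied_pairs f A. x \<in> B}) = card {y \<in> A. f y = f x}"
proof -
  have "{B \<in> tied_pairs f A. x \<in> B} = (\<lambda>y. {x, y}) ` ({y \<in> A. f y = f x} - {x})"
    using \<open>x \<in> A\<close> by (auto elim!: tied_pairs_E)
  moreover have "inj_on (\<lambda>y. {x, y}) ({y \<in> A. f y = f x} - {x})"
    by (auto simp: inj_on_def doubleton_eq_iff)
  ultimately have "card {B \<in> tied_pairs f A. x \<in> B} = card ({y \<in> A. f y = f x} - {x})"
    by (simp add: card_image)
  then show ?thesis
    using assms card_Suc_Diff1[of "{y \<in> A. f y = f x}" x] by simp
qed

lemma sum_card_fibre:
  assumes "finite A"
  shows "(\<Sum>x\<in>A. card {y \<in> A. f y = f x}) = card A + 2 * card (tied_pairs f A)"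
proof -
  have "{x \<in> A. x \<in> B} = B \<and> card B = 2" if "B \<in> tied_pairs f A" for B
    using that by (auto simp: tied_pairs_def nsets_def)
  then have "(\<Sum>x\<in>A. card {B \<in> tied_pairs f A. x \<in> B}) = 2 * card (tied_pairs f A)"
    using assms by (intro sum_multicount finite_tied_pairs) auto
  then show ?thesis
    using assms by (simp add: card_tied_pairs_containing[symmetric] sum_Suc)
qed

lemma card_tied_pairs_le:
  assumes "finite A" and "\<And>x. x \<in> A \<Longrightarrow> card {y \<in> A. f y = f x} \<le> Suc k"
  shows "2 * card (tied_pairs f A) \<le> k * card A"
proof -
  have "card A + 2 * card (tied_pairs f A) = (\<Sum>x\<in>A. card {y \<in> A. f y = f x})"
    using assms(1) by (simp add: sum_card_fibre)
  also have "\<dots> \<le> card A * Suc k"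
    using sum_bounded_above[of A, OF assms(2)] by simp
  finally show ?thesis by (simp add: mult.commute)
qed

lemma card_le_card_image_plus_tied_pairs:
  assumes "finite A"
  shows "card A \<le> card (f ` A) + card (tied_pairs f A)"
  using assms
proof (induction A rule: finite_induct)
  case (insert x A)
  have mono: "tied_pairs f A \<subseteq> tied_pairs f (insert x A)"
    by (intro tied_pairs_mono) auto
  have fin: "finite (tied_pairs f (insert x A))"
    using insert.hyps by (simp add: finite_tied_pairs)
  show ?case
  proof (cases "f x \<in> f ` A")
    case True
    then obtain y where y: "y \<in> A" "f x = f y" by blast
    then have "{x, y} \<in> tied_pairs f (insert x A) - tied_pairs f A"
      using insert.hyps by auto
    then have "card (tied_pairs f A) < card (tied_pairs f (insert x A))"
      using mono by (intro psubset_card_mono[OF fin]) blast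
    then show ?thesis
      using insert True by (simp add: insert_absorb)
  next
    case False
    then show ?thesis
      using insert card_mono[OF fin mono] by simp
  qed
qed simp

lemma card_tied_pairs_neq_2:
  assumes "card A = 3"
  shows "card (tied_pairs f A) \<noteq> 2"
proof
  assume card_eq_2: "card (tied_pairs f A) = 2"
  obtain x y z where A: "A = {x, y, z}" "x \<noteq> y" "y \<noteq> z" "x \<noteq> z"
    using assms by (auto simp: card_3_iff)
  obtain B C where "B \<in> tied_pairs f A" "C \<in> tied_pairs f A" "B \<noteq> C"
    using card_eq_2 by (auto simp: card_2_iff)
  then have "f u = f v" if "u \<in> A" "v \<in> A" for u v
    using that A by (auto elim!: tied_pairs_E)
  then have "tied_pairs f A = [A]\<^bsup>2\<^esup>"
    by (rule tied_pairs_eq_nsets)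
  then show False
    using card_eq_2 assms by (simp add: choose_two)
qed

section \<open>Distances in digraphs\<close>

context wf_digraph
begin

lemma graph_dist_le: "awalk u p v \<Longrightarrow> graph_dist G u v \<le> length p"
  unfolding graph_dist_def by (rule Least_le) blast

lemma shortest_awalk:
  assumes "u \<rightarrow>\<^sup>* v"
  obtains p where "awalk u p v" "length p = graph_dist G u v"
proof -
  have "\<exists>n p. awalk u p v \<and> length p = n"
    using assms by (simp add: reachable_awalk)
  then have "\<exists>p. awalk u p v \<and> length p = graph_dist G u v"
    unfolding graph_dist_def by (rule LeastI_ex)
  then show thesis using that by blast
qed

lemma graph_dist_eq_0_iff:
  assumes "u \<rightarrow>\<^sup>* v"
  shows "graph_dist G u v = 0 \<longleftrightarrow> u = v"
proof
  assume "graph_dist G u v = 0"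
  then show "u = v"
    using shortest_awalk[OF assms] by (metis awalk_empty_ends length_0_conv)
next
  assume "u = v"
  then show "graph_dist G u v = 0"
    using graph_dist_le[of u "[]" v] assms by (simp add: awalk_Nil_iff reachable_in_verts)
qed

lemma graph_dist_triangle:
  assumes "u \<rightarrow>\<^sup>* v" "v \<rightarrow>\<^sup>* w"
  shows "graph_dist G u w \<le> graph_dist G u v + graph_dist G v w"
proof -
  obtain p where p: "awalk u p v" "length p = graph_dist G u v"
    using shortest_awalk[OF assms(1)] .
  obtain q where q: "awalk v q w" "length q = graph_dist G v w"
    using shortest_awalk[OF assms(2)] .
  show ?thesis
    using graph_dist_le[OF awalk_appendI[OF p(1) q(1)]] p q by simp
qed

end

lemma (in loopfree_digraph) graph_dist_eq_1_iff:
  assumes "u \<rightarrow>\<^sup>* v"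
  shows "graph_dist G u v = 1 \<longleftrightarrow> u \<rightarrow>\<^bsub>G\<^esub> v"
proof
  assume "graph_dist G u v = 1"
  then obtain p where p: "awalk u p v" "length p = 1"
    using shortest_awalk[OF assms] by metis
  then obtain e where "p = [e]" by (auto simp: length_Suc_conv)
  then show "u \<rightarrow>\<^bsub>G\<^esub> v"
    using p in_arcs_imp_in_arcs_ends[of e] by (auto simp: awalk_simps)
next
  assume "u \<rightarrow>\<^bsub>G\<^esub> v"
  then obtain e where e: "e \<in> arcs G" "tail G e = u" "head G e = v" by auto
  then have "graph_dist G u v \<le> 1"
    using graph_dist_le[of u "[e]" v] arc_implies_awalk[of e] by simp
  moreover have "graph_dist G u v \<noteq> 0"
    using graph_dist_eq_0_iff[OF assms] no_loops[OF e(1)] e by simp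
  ultimately show "graph_dist G u v = 1" by simp
qed

lemma (in loopfree_digraph) graph_dist_SucE:
  assumes "u \<rightarrow>\<^sup>* v" "graph_dist G u v = Suc k"
  obtains x where "x \<in> verts G" "graph_dist G u x = k" "graph_dist G x v = 1"
proof -
  obtain p where p: "awalk u p v" "length p = Suc k"
    using shortest_awalk[OF assms(1)] assms(2) by metis
  then obtain q e where pq: "p = q @ [e]" by (metis length_Suc_conv_rev)
  then have e: "e \<in> arcs G" "head G e = v" and q: "awalk u q (tail G e)"
    using p by (auto simp: awalk_simps)
  have reach: "u \<rightarrow>\<^sup>* tail G e" "tail G e \<rightarrow>\<^sup>* v"
    using q e arc_implies_awalk[of e] by (auto intro: reachable_awalkI)
  have "graph_dist G (tail G e) v = 1"
    using graph_dist_eq_1_iff[OF reach(2)] in_arcs_imp_in_arcs_ends[OF e(1)] e by simp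
  moreover have "graph_dist G u (tail G e) \<le> k"
    using graph_dist_le[OF q] p pq by simp
  ultimately show thesis
    using that[of "tail G e"] graph_dist_triangle[OF reach] assms(2) e by simp
qed

lemma (in nomulti_digraph) out_degree_eq_card_dominated: "out_degree G v = card {x. v \<rightarrow>\<^bsub>G\<^esub> x}"
proof -
  have "inj_on (head G) (out_arcs G v)"
    by (rule inj_onI) (auto intro: no_multi_arcs simp: arc_to_ends_def)
  moreover have "head G ` out_arcs G v = {x. v \<rightarrow>\<^bsub>G\<^esub> x}"
    by (force simp: arcs_ends_conv)
  ultimately show ?thesis
    unfolding out_degree_def by (metis card_image)
qed

context sym_digraph
begin

lemma awalk_reverse: "awalk u p v \<Longrightarrow> \<exists>q. awalk v q u \<and> length q = length p"
proof (induction p arbitrary: u)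
  case Nil
  then show ?case by (auto simp: awalk_Nil_iff intro!: exI[of _ "[]"])
next
  case (Cons e es)
  then have e: "e \<in> arcs G" "u = tail G e" "awalk (head G e) es v"
    by (auto simp: awalk_Cons_iff)
  obtain q where q: "awalk v q (head G e)" "length q = length es"
    using Cons.IH e by blast
  have "(head G e, tail G e) \<in> arcs_ends G"
    using in_arcs_imp_in_arcs_ends[OF e(1)] sym_arcs by (auto simp: symmetric_def dest: symD)
  then obtain e' where "e' \<in> arcs G" "tail G e' = head G e" "head G e' = tail G e"
    by (auto simp: arcs_ends_conv)
  then have "awalk v (q @ [e']) u"
    using q e by (intro awalk_appendI[OF q(1)]) (auto simp: awalk_simps)
  then show ?case using q by (intro exI[of _ "q @ [e']"]) simp
qed

lemma graph_dist_sym: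
  assumes "u \<rightarrow>\<^sup>* v"
  shows "graph_dist G u v = graph_dist G v u"
proof -
  have "graph_dist G y x \<le> graph_dist G x y" if "x \<rightarrow>\<^sup>* y" for x y
    using shortest_awalk[OF that] awalk_reverse graph_dist_le by metis
  from this[OF assms] this[OF symmetric_reachable'[OF assms]] show ?thesis
    by (rule antisym[rotated])
qed

end

section \<open>Spheres and equidistant vertices\<close>

lemma metric_dim_le: "resolving_set G W \<Longrightarrow> metric_dim G \<le> card W"
  unfolding metric_dim_def by (rule Least_le) blast

locale connected_graph = graph +
  assumes connected: "Digraph_Component.connected G"
begin

declare One_nat_def [simp del]

abbreviation V :: "'a set" where "V \<equiv> verts G"
abbreviation d :: "'a \<Rightarrow> 'a \<Rightarrow> nat" where "d \<equiv> graph_dist G"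

lemma reachable: "\<lbrakk>u \<in> V; v \<in> V\<rbrakk> \<Longrightarrow> u \<rightarrow>\<^sup>* v"
  using symmetric_connected_imp_strongly_connected[OF sym_arcs connected]
  by (simp add: strongly_connected_def)

lemmas dist_eq_0_iff [simp] = graph_dist_eq_0_iff[OF reachable]
  and dist_sym = graph_dist_sym[OF reachable]
  and dist_triangle = graph_dist_triangle[OF reachable reachable]
  and dist_SucE = graph_dist_SucE[OF reachable]

lemma dist_self [simp]: "v \<in> V \<Longrightarrow> d v v = 0"
  by simp

definition sphere :: "'a \<Rightarrow> nat \<Rightarrow> 'a set" where
  "sphere w k = {x \<in> V. d w x = k}"

definition outside :: "'a \<Rightarrow> nat \<Rightarrow> 'a set" where
  "outside w k = {x \<in> V. k \<le> d w x}"

definition equidistant :: "'a set \<Rightarrow> 'a set" where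
  "equidistant B = {z \<in> V. \<forall>x\<in>B. \<forall>y\<in>B. d z x = d z y}"

lemma mem_sphere [simp]: "x \<in> sphere w k \<longleftrightarrow> x \<in> V \<and> d w x = k"
  by (simp add: sphere_def)

lemma finite_sphere [simp]: "finite (sphere w k)"
  by (simp add: sphere_def)

lemma sphere_0 [simp]: "w \<in> V \<Longrightarrow> sphere w 0 = {w}"
  by auto

lemma mem_outside [simp]: "x \<in> outside w k \<longleftrightarrow> x \<in> V \<and> k \<le> d w x"
  by (simp add: outside_def)

lemma finite_outside [simp]: "finite (outside w k)"
  by (simp add: outside_def)

lemma outside_0 [simp]: "outside w 0 = V"
  by (simp add: outside_def)

lemma outside_eq_sphere_Un: "outside w k = sphere w k \<union> outside w (Suc k)"
  by auto

lemma card_outside: "card (outside w k) = card (sphere w k) + card (outside w (Suc k))"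
  by (subst outside_eq_sphere_Un) (auto intro: card_Un_disjoint)

lemma tied_pairs_sphere: "tied_pairs (d w) (sphere w k) = [sphere w k]\<^bsup>2\<^esup>"
  by (rule tied_pairs_eq_nsets) simp

lemma card_tied_pairs_outside:
  "card (tied_pairs (d w) (outside w k)) =
    (card (sphere w k) choose 2) + card (tied_pairs (d w) (outside w (Suc k)))"
proof -
  have "d w ` sphere w k \<inter> d w ` outside w (Suc k) = {}" by auto
  then show ?thesis
    by (subst outside_eq_sphere_Un) (simp add: card_tied_pairs_Un tied_pairs_sphere)
qed

lemma card_verts_eq:
  "w \<in> V \<Longrightarrow> card V = 1 + card (sphere w 1) + card (outside w 2)"
  using card_outside[of w 0] card_outside[of w 1] by (simp add: eval_nat_numeral One_nat_def)

lemma card_tied_pairs_verts_eq: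
  "w \<in> V \<Longrightarrow> card (tied_pairs (d w) V) =
    (card (sphere w 1) choose 2) + card (tied_pairs (d w) (outside w 2))"
  using card_tied_pairs_outside[of w 0] card_tied_pairs_outside[of w 1]
  by (simp add: eval_nat_numeral One_nat_def)

lemma mem_equidistant_doubleton [simp]:
  "z \<in> equidistant {x, y} \<longleftrightarrow> z \<in> V \<and> d z x = d z y"
  by (auto simp: equidistant_def)

lemma equidistant_subset: "equidistant B \<subseteq> V"
  by (auto simp: equidistant_def)

lemma finite_equidistant [simp]: "finite (equidistant B)"
  using finite_subset[OF equidistant_subset] by simp

lemma tied_pairs_dist:
  "z \<in> V \<Longrightarrow> tied_pairs (d z) A = {B \<in> [A]\<^bsup>2\<^esup>. z \<in> equidistant B}"
  by (simp add: tied_pairs_def equidistant_def)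

lemma equidistant_disjoint:
  assumes "B \<in> [V]\<^bsup>2\<^esup>"
  shows "B \<inter> equidistant B = {}"
  using assms by (auto elim!: nsets2_E)

lemma out_degree_eq_card_sphere:
  assumes "v \<in> V"
  shows "out_degree G v = card (sphere v 1)"
proof -
  have "{x. v \<rightarrow>\<^bsub>G\<^esub> x} = sphere v 1"
    using graph_dist_eq_1_iff[OF reachable[OF assms]] by (auto simp: sphere_def dest: adj_in_verts)
  then show ?thesis by (simp add: out_degree_eq_card_dominated)
qed

lemma neighbour_sym: "\<lbrakk>u \<in> V; v \<in> V\<rbrakk> \<Longrightarrow> u \<in> sphere v 1 \<longleftrightarrow> v \<in> sphere u 1"
  by (simp add: dist_sym)

lemma sphere_SucE:
  assumes "w \<in> V" "x \<in> sphere w (Suc k)"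
  obtains u where "u \<in> sphere w k" "x \<in> sphere u 1"
  using dist_SucE[of w x k] assms by auto

lemma sphere_2_subset:
  assumes "w \<in> V"
  shows "sphere w 2 \<subseteq> (\<Union>u\<in>sphere w 1. sphere u 1 - {w})"
proof
  fix x assume x: "x \<in> sphere w 2"
  then obtain u where "u \<in> sphere w 1" "x \<in> sphere u 1"
    using sphere_SucE[OF assms, of x 1] by (auto simp: numeral_2_eq_2 One_nat_def)
  moreover have "x \<noteq> w" using x assms by auto
  ultimately show "x \<in> (\<Union>u\<in>sphere w 1. sphere u 1 - {w})" by blast
qed

lemma farthest_neighbours_subset_sphere:
  assumes w: "w \<in> V" and v: "sphere w (d w v) = {v}"
    and farthest: "\<And>x. x \<in> V \<Longrightarrow> d w x \<le> d w v"
  shows "sphere v 1 \<subseteq> sphere w (d w v - 1)"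
proof
  fix t assume t: "t \<in> sphere v 1"
  have vV: "v \<in> V" using v by auto
  then have "t \<notin> sphere w (d w v)" unfolding v using t by auto
  moreover have "d w v \<le> d w t + 1"
    using dist_triangle[of w t v] dist_sym[of t v] t vV w by simp
  ultimately show "t \<in> sphere w (d w v - 1)"
    using farthest[of t] t by simp
qed

lemma neighbour_closer:
  assumes "w \<in> V" "z \<in> V" "z \<noteq> w"
  obtains u where "u \<in> sphere w 1" "d z w = Suc (d z u)"
proof -
  obtain k where k: "d z w = Suc k"
    using assms by (cases "d z w") auto
  then obtain u where "u \<in> V" "d z u = k" "d u w = 1"
    using dist_SucE[of z w k] assms by blast
  then show thesis
    using that[of u] k assms by (simp add: dist_sym)
qed

lemma card_dist_closed_neighbourhood_le_3:
  assumes "w \<in> V" "z \<in> V" "A \<subseteq> insert w (sphere w 1)"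
  shows "card (d z ` A) \<le> 3"
proof -
  have "d z u \<in> {d z w - 1..d z w + 1}" if "u \<in> A" for u
  proof (cases "u = w")
    case False
    then have u: "u \<in> V" "d w u = 1" using that assms by auto
    then show ?thesis
      using dist_triangle[of z w u] dist_triangle[of z u w] dist_sym[of u w] assms by simp
  qed simp
  then have "card (d z ` A) \<le> card {d z w - 1..d z w + 1}"
    by (intro card_mono) auto
  then show ?thesis by simp
qed

lemma resolving_set_iff:
  "resolving_set G W \<longleftrightarrow> W \<subseteq> V \<and> (\<forall>B\<in>[V]\<^bsup>2\<^esup>. \<not> W \<subseteq> equidistant B)"
proof -
  have "metric_rep G W x = metric_rep G W y \<longleftrightarrow> W \<subseteq> equidistant {x, y}"
    if "W \<subseteq> V" "x \<in> V" "y \<in> V" for x y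
  proof -
    have "metric_rep G W x = metric_rep G W y \<longleftrightarrow> (\<forall>w\<in>W. d x w = d y w)"
      by (auto simp: metric_rep_def restrict_def fun_eq_iff)
    also have "\<dots> \<longleftrightarrow> (\<forall>w\<in>W. d w x = d w y)"
      using that by (intro ball_cong) (auto simp: dist_sym)
    also have "\<dots> \<longleftrightarrow> W \<subseteq> equidistant {x, y}"
      using that by auto
    finally show ?thesis .
  qed
  then show ?thesis
    unfolding resolving_set_def inj_on_def nsets_2_eq by blast
qed

lemma metric_dim_less_order: "metric_dim G < card V"
proof -
  obtain v where v: "v \<in> V"
    using connected by (auto simp: connected_def strongly_connected_def)
  have "\<not> V - {v} \<subseteq> equidistant B" if B: "B \<in> [V]\<^bsup>2\<^esup>" for B
  proof
    assume "V - {v} \<subseteq> equidistant B"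
    then have "B \<subseteq> {v}"
      using equidistant_disjoint[OF B] B by (auto simp: nsets_def)
    then show False
      using B card_mono[of "{v}" B] by (simp add: nsets_def)
  qed
  then have "metric_dim G \<le> card (V - {v})"
    by (intro metric_dim_le) (auto simp: resolving_set_iff)
  also have "\<dots> < card V"
    using v by (intro psubset_card_mono) auto
  finally show ?thesis .
qed

lemma subset_equidistantE:
  assumes "W \<subseteq> V" "card W < metric_dim G"
  obtains B where "B \<in> [V]\<^bsup>2\<^esup>" "W \<subseteq> equidistant B"
  using assms metric_dim_le[of G W] by (auto simp: resolving_set_iff)

lemma card_equidistant_less:
  assumes "randomly_dimensional k G" and B: "B \<in> [V]\<^bsup>2\<^esup>"
  shows "card (equidistant B) < k"
proof (rule ccontr)
  assume "\<not> ?thesis"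
  then obtain W where W: "W \<subseteq> equidistant B" "card W = k"
    by (meson not_less obtain_subset_with_card_n)
  then have "resolving_set G W"
    using assms equidistant_subset[of B] by (auto simp: randomly_dimensional_def metric_basis_def)
  then show False
    using W B by (auto simp: resolving_set_iff)
qed

end

section \<open>Counting equidistant pairs\<close>

locale randomly_3_dimensional_graph = connected_graph +
  assumes randomly_3_dimensional: "randomly_dimensional 3 G"
begin

lemma metric_dim_eq_3: "metric_dim G = 3"
  using randomly_3_dimensional by (simp add: randomly_dimensional_def)

lemma order_gt_3: "3 < card V"
  using metric_dim_less_order metric_dim_eq_3 by simp

lemma bij_betw_equidistant: "bij_betw equidistant ([V]\<^bsup>2\<^esup>) ([V]\<^bsup>2\<^esup>)"
proof -
  have fin: "finite ([V]\<^bsup>2\<^esup>)"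
    by (simp add: finite_imp_finite_nsets)
  have surj: "[V]\<^bsup>2\<^esup> \<subseteq> equidistant ` [V]\<^bsup>2\<^esup>"
  proof
    fix A assume "A \<in> [V]\<^bsup>2\<^esup>"
    then have A: "A \<subseteq> V" "card A = 2" by (auto simp: nsets_def)
    then obtain B where B: "B \<in> [V]\<^bsup>2\<^esup>" "A \<subseteq> equidistant B"
      using subset_equidistantE[of A] metric_dim_eq_3 by auto
    then have "A = equidistant B"
      using card_equidistant_less[OF randomly_3_dimensional B(1)] A by (intro card_seteq) auto
    then show "A \<in> equidistant ` [V]\<^bsup>2\<^esup>" using B by blast
  qed
  moreover have "equidistant ` [V]\<^bsup>2\<^esup> = [V]\<^bsup>2\<^esup>"
    using card_seteq[OF _ surj card_image_le[OF fin]] fin by simp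
  ultimately show ?thesis
    using finite_surj_inj[OF fin] by (simp add: bij_betw_def)
qed

lemma card_equidistant: "B \<in> [V]\<^bsup>2\<^esup> \<Longrightarrow> card (equidistant B) = 2"
  using bij_betwE[OF bij_betw_equidistant] by (auto simp: nsets_def)

lemma not_three_equidistant:
  assumes "x \<in> V" "y \<in> V" "x \<noteq> y" "{p, q, r} \<subseteq> equidistant {x, y}"
  shows "p = q \<or> p = r \<or> q = r"
proof (rule ccontr)
  assume "\<not> ?thesis"
  moreover have "card {p, q, r} \<le> card (equidistant {x, y})"
    using assms by (intro card_mono) auto
  ultimately show False
    using card_equidistant[of "{x, y}"] assms by simp
qed

lemma equidistant_neqE:
  assumes "x \<in> V" "y \<in> V" "x \<noteq> y"
  obtains z where "z \<in> V" "d z x = d z y" "z \<noteq> t"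
proof -
  have "\<not> equidistant {x, y} \<subseteq> {t}"
    using card_equidistant[of "{x, y}"] assms card_mono[of "{t}" "equidistant {x, y}"] by auto
  then obtain z where "z \<in> equidistant {x, y}" "z \<noteq> t" by blast
  then show thesis using that[of z] by simp
qed

lemma card_tied_pairs_dist:
  assumes w: "w \<in> V"
  shows "card (tied_pairs (d w) V) = card V - 1"
proof -
  have "equidistant ` tied_pairs (d w) V = {A \<in> equidistant ` [V]\<^bsup>2\<^esup>. w \<in> A}"
    by (auto simp: tied_pairs_dist[OF w])
  also have "\<dots> = {A \<in> tied_pairs (\<lambda>_. ()) V. w \<in> A}"
    using bij_betw_imp_surj_on[OF bij_betw_equidistant] by (simp add: tied_pairs_eq_nsets)
  finally have "bij_betw equidistant (tied_pairs (d w) V) {A \<in> tied_pairs (\<lambda>_. ()) V. w \<in> A}"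
    by (intro bij_betw_subset[OF bij_betw_equidistant]) (auto simp: tied_pairs_def)
  then show ?thesis
    using card_tied_pairs_containing[of V w "\<lambda>_. ()"] w by (simp add: bij_betw_same_card)
qed

lemma sum_card_tied_pairs_dist:
  assumes "A \<subseteq> V"
  shows "(\<Sum>z\<in>V. card (tied_pairs (d z) A)) = 2 * (card A choose 2)"
proof -
  have "card {z \<in> V. z \<in> equidistant B} = 2" if "B \<in> [A]\<^bsup>2\<^esup>" for B
  proof -
    have "{z \<in> V. z \<in> equidistant B} = equidistant B"
      using equidistant_subset by auto
    then show ?thesis
      using that nsets_mono[OF assms] card_equidistant[of B] by auto
  qed
  then have "(\<Sum>z\<in>V. card {B \<in> [A]\<^bsup>2\<^esup>. z \<in> equidistant B}) = 2 * card ([A]\<^bsup>2\<^esup>)"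
    using finite_subset[OF assms] by (intro sum_multicount finite_imp_finite_nsets) auto
  then show ?thesis by (simp add: tied_pairs_dist)
qed

lemma closed_neighbourhood_tied_pairs_le:
  assumes w: "w \<in> V" and A: "A \<subseteq> insert w (sphere w 1)"
  shows "(card V - 1) * (card A - 3) + card (tied_pairs (d w) A) \<le> 2 * (card A choose 2)"
proof -
  have AV: "A \<subseteq> V" using A w by auto
  then have "finite A" by (rule finite_subset) simp
  then have "card A - 3 \<le> card (tied_pairs (d z) A)" if "z \<in> V" for z
    using card_le_card_image_plus_tied_pairs[of A "d z"]
      card_dist_closed_neighbourhood_le_3[OF w that A] by linarith
  then have "(\<Sum>z\<in>V - {w}. card A - 3) \<le> (\<Sum>z\<in>V - {w}. card (tied_pairs (d z) A))"
    by (intro sum_mono) auto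
  then have "(card V - 1) * (card A - 3) \<le> (\<Sum>z\<in>V - {w}. card (tied_pairs (d z) A))"
    using w by simp
  then show ?thesis
    using sum_card_tied_pairs_dist[OF AV] w
    by (simp add: sum.remove[of V w "\<lambda>z. card (tied_pairs (d z) A)"])
qed

section \<open>The degrees\<close>

lemma degree_ge_2:
  assumes w: "w \<in> V"
  shows "2 \<le> card (sphere w 1)"
proof -
  have "\<not> V \<subseteq> {w}"
    using order_gt_3 card_mono[of "{w}" V] by auto
  then obtain u where u: "u \<in> sphere w 1"
    using neighbour_closer[OF w] by blast
  then have "u \<noteq> w" using w by auto
  then obtain z where z: "z \<in> V" "d z w = d z u"
    using equidistant_neqE[of w u] w u by auto
  then have "z \<noteq> w" using u w \<open>u \<noteq> w\<close> by auto
  then obtain u' where u': "u' \<in> sphere w 1" "d z w = Suc (d z u')"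
    using neighbour_closer w z by blast
  then have "u \<noteq> u'" using z by auto
  then show ?thesis
    using card_mono[of "sphere w 1" "{u, u'}"] u u' by simp
qed

lemma
  assumes w: "w \<in> V" and deg: "3 < card (sphere w 1)"
  shows degree_gt_3_imp_degree_eq_4: "card (sphere w 1) = 4"
    and degree_gt_3_imp_order_eq_7: "card V = 7"
    and degree_gt_3_imp_tied_pairs_dist_eq: "tied_pairs (d w) V = [sphere w 1]\<^bsup>2\<^esup>"
proof -
  define m where "m = card (sphere w 1)"
  have neighbour_pairs_tied: "[sphere w 1]\<^bsup>2\<^esup> \<subseteq> tied_pairs (d w) V"
    unfolding tied_pairs_sphere[symmetric] by (rule tied_pairs_mono) auto
  then have choose_le: "m choose 2 \<le> card V - 1"
    using card_mono[OF finite_tied_pairs neighbour_pairs_tied] card_tied_pairs_dist[OF w]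
    by (simp add: m_def)
  have "(card V - 1) * (m - 3) + (m choose 2) \<le> 2 * (m choose 2)"
    using closed_neighbourhood_tied_pairs_le[OF w subset_insertI]
    by (simp add: tied_pairs_sphere m_def)
  then have le_choose: "(card V - 1) * (m - 3) \<le> m choose 2"
    by simp
  then have "(card V - 1) * (m - 3) \<le> (card V - 1) * 1"
    using choose_le by linarith
  then have "m - 3 \<le> 1"
    by (rule mult_left_le_imp_le) (use order_gt_3 in simp)
  then show degree_eq_4: "card (sphere w 1) = 4"
    using deg by (simp add: m_def)
  then have "m choose 2 = 6" "m - 3 = 1"
    by (simp_all add: m_def choose_two)
  then show order_eq_7: "card V = 7"
    using choose_le le_choose by simp
  show "tied_pairs (d w) V = [sphere w 1]\<^bsup>2\<^esup>"
    using card_seteq[OF finite_tied_pairs neighbour_pairs_tied] card_tied_pairs_dist[OF w]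
      degree_eq_4 order_eq_7
    by (simp add: choose_two)
qed

lemma degree_gt_3_imp_card_other_sphere_le_1:
  assumes "w \<in> V" "3 < card (sphere w 1)" "k \<noteq> 1"
  shows "card (sphere w k) \<le> 1"
proof -
  have "x = y" if "x \<in> sphere w k" "y \<in> sphere w k" for x y
  proof (rule ccontr)
    assume "x \<noteq> y"
    then have "{x, y} \<in> tied_pairs (d w) V" using that by simp
    then show False
      unfolding degree_gt_3_imp_tied_pairs_dist_eq[OF assms(1,2)] using that assms(3) by simp
  qed
  then show ?thesis
    by (simp add: One_nat_def card_le_Suc0_iff_eq del: mem_sphere)
qed

lemma degree_le_3:
  assumes w: "w \<in> V"
  shows "card (sphere w 1) \<le> 3"
proof (rule ccontr)
  assume "\<not> ?thesis"
  then have deg: "3 < card (sphere w 1)" by simp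
  note card_sphere_le = degree_gt_3_imp_card_other_sphere_le_1[OF w deg]
  have "card V = 1 + card (sphere w 1) + (card (sphere w 2) + card (outside w 3))"
    using card_verts_eq[OF w] card_outside[of w 2] by simp
  then have "0 < card (outside w 3)"
    using degree_gt_3_imp_degree_eq_4[OF w deg] degree_gt_3_imp_order_eq_7[OF w deg] card_sphere_le[of 2]
    by linarith
  then obtain y where y: "y \<in> V" "3 \<le> d w y" by (auto simp: card_gt_0_iff)
  obtain v where v: "v \<in> V" "Max (d w ` V) = d w v"
    using obtains_MAX[of V "d w"] w by auto
  then have farthest: "d w x \<le> d w v" if "x \<in> V" for x
    using that by (simp flip: v(2))
  then have far: "3 \<le> d w v" using y le_trans by blast
  have "card (sphere w (d w v)) \<le> card {v}"
    using card_sphere_le[of "d w v"] far by (simp add: One_nat_def)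
  then have "sphere w (d w v) = {v}"
    using v card_seteq[of "sphere w (d w v)" "{v}"] by simp
  then have "card (sphere v 1) \<le> card (sphere w (d w v - 1))"
    using farthest_neighbours_subset_sphere[OF w] farthest by (intro card_mono) simp_all
  also have "\<dots> \<le> 1"
    using card_sphere_le[of "d w v - 1"] far by simp
  finally show False using degree_ge_2[OF v(1)] by simp
qed

lemma order_le_10:
  assumes w: "w \<in> V" and deg: "card (sphere w 1) = 3"
  shows "card V \<le> 10"
proof -
  have card_closed: "card (insert w (sphere w 1)) = 4" using w deg by simp
  have "3 choose 2 \<le> card (tied_pairs (d w) (insert w (sphere w 1)))"
    using card_mono[OF finite_tied_pairs tied_pairs_mono, of "insert w (sphere w 1)" "sphere w 1" "d w"]
    by (simp add: tied_pairs_sphere deg subset_insertI)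
  then show ?thesis
    using closed_neighbourhood_tied_pairs_le[OF w subset_refl] unfolding card_closed
    by (simp add: choose_two)
qed

text \<open>Two vertices at distance \<open>k + 1\<close> from \<open>w\<close> with a common neighbour \<open>u\<close> at distance \<open>k \<ge> 2\<close> would
  be equidistant from \<open>w\<close>, from \<open>u\<close> and from a neighbour of \<open>u\<close> at distance \<open>k - 1\<close>.\<close>

lemma sphere_Suc_common_neighbour_unique:
  assumes w: "w \<in> V" and k: "2 \<le> k" and u: "u \<in> sphere w k"
    and x: "x \<in> sphere w (Suc k)" "x \<in> sphere u 1" and y: "y \<in> sphere w (Suc k)" "y \<in> sphere u 1"
  shows "x = y"
proof (rule ccontr)
  assume "x \<noteq> y"
  obtain t where t: "t \<in> sphere w (k - 1)" "u \<in> sphere t 1"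
    using sphere_SucE[of w u "k - 1"] w u k by auto
  have "d t z = 2" if "z \<in> sphere w (Suc k)" "z \<in> sphere u 1" for z
    using dist_triangle[of t u z] dist_triangle[of w t z] that t u w k by simp
  then have "{w, u, t} \<subseteq> equidistant {x, y}"
    using x y t u w by simp
  then have "w = u \<or> w = t \<or> u = t"
    using not_three_equidistant[of x y w u t] x y \<open>x \<noteq> y\<close> by auto
  then show False using t u w k by auto
qed

lemma card_sphere_Suc_le:
  assumes w: "w \<in> V" and k: "2 \<le> k"
  shows "card (sphere w (Suc k)) \<le> card (sphere w k)"
proof (rule card_le_if_inj_on_rel[where r = "\<lambda>x u. x \<in> sphere u 1"])
  show "\<exists>u. u \<in> sphere w k \<and> x \<in> sphere u 1" if "x \<in> sphere w (Suc k)" for x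
    using sphere_SucE[OF w that] by blast
qed (use sphere_Suc_common_neighbour_unique[OF w k] in auto)

lemma card_sphere_le_card_sphere_2:
  assumes "w \<in> V" "2 \<le> k"
  shows "card (sphere w k) \<le> card (sphere w 2)"
  using assms(2)
proof (induction k rule: dec_induct)
  case (step k)
  then show ?case using card_sphere_Suc_le[OF assms(1), of k] by linarith
qed simp

lemma degree_2_imp_card_sphere_2_ge_4:
  assumes w: "w \<in> V" and deg: "card (sphere w 1) = 2"
  shows "4 \<le> card (sphere w 2)"
proof (rule ccontr)
  assume not_ge_4: "\<not> ?thesis"
  have "card {y \<in> outside w 2. d w y = d w x} \<le> Suc 2" if "x \<in> outside w 2" for x
  proof -
    have "card {y \<in> outside w 2. d w y = d w x} \<le> card (sphere w (d w x))"
      by (intro card_mono) auto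
    also have "\<dots> \<le> card (sphere w 2)"
      using card_sphere_le_card_sphere_2[OF w] that by simp
    finally show ?thesis using not_ge_4 by simp
  qed
  then have "card (tied_pairs (d w) (outside w 2)) \<le> card (outside w 2)"
    using card_tied_pairs_le[of "outside w 2" "d w" 2] by simp
  moreover have "card V = 3 + card (outside w 2)"
    using card_verts_eq[OF w] deg by simp
  moreover have "card V - 1 = 1 + card (tied_pairs (d w) (outside w 2))"
    using card_tied_pairs_dist[OF w] card_tied_pairs_verts_eq[OF w] deg by simp
  ultimately show False by simp
qed

lemma
  assumes w: "w \<in> V" and nbrs: "sphere w 1 = {a, b}" "a \<noteq> b"
  shows degree_2_imp_neighbour_degree_eq_3: "card (sphere a 1) = 3"
    and degree_2_imp_card_sphere_2_eq_4: "card (sphere w 2) = 4"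
    and degree_2_imp_sphere_2_eq: "sphere w 2 = (sphere a 1 - {w}) \<union> (sphere b 1 - {w})"
    and degree_2_imp_neighbourhoods_Int: "sphere a 1 \<inter> sphere b 1 = {w}"
proof -
  define A B where "A = sphere a 1 - {w}" and "B = sphere b 1 - {w}"
  have ab: "a \<in> sphere w 1" "b \<in> sphere w 1" using nbrs by auto
  then have wab: "w \<in> sphere a 1" "w \<in> sphere b 1"
    using neighbour_sym w by auto
  have fin: "finite A" "finite B" by (simp_all add: A_def B_def)
  have card_le: "card A \<le> 2" "card B \<le> 2"
    using degree_le_3[of a] degree_le_3[of b] wab ab by (auto simp: A_def B_def)
  have sphere_2_sub: "sphere w 2 \<subseteq> A \<union> B"
    using sphere_2_subset[OF w] unfolding nbrs A_def B_def by simp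
  have "4 \<le> card (sphere w 2)"
    using degree_2_imp_card_sphere_2_ge_4[OF w] nbrs by simp
  moreover have "card (sphere w 2) \<le> card (A \<union> B)"
    using sphere_2_sub fin by (intro card_mono) auto
  moreover have "card (A \<union> B) + card (A \<inter> B) = card A + card B"
    using card_Un_Int[OF fin] by simp
  ultimately have card_eq: "card (sphere w 2) = 4" "card (A \<union> B) = 4" "card A = 2" "card (A \<inter> B) = 0"
    using card_le by linarith+
  then show "card (sphere w 2) = 4" by simp
  show "card (sphere a 1) = 3"
    using card_eq wab by (simp add: A_def)
  show "sphere w 2 = (sphere a 1 - {w}) \<union> (sphere b 1 - {w})"
    using card_seteq[OF _ sphere_2_sub] fin card_eq by (simp add: A_def B_def)
  have "A \<inter> B = {}" using card_eq fin by simp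
  then show "sphere a 1 \<inter> sphere b 1 = {w}"
    using wab by (auto simp: A_def B_def simp del: mem_sphere)
qed

lemma degree_2_equidistant_neighbour_second_sphere_unique:
  assumes w: "w \<in> V" and nbrs: "sphere w 1 = {a, b}" "a \<noteq> b"
    and x: "x \<in> equidistant {w, b} \<inter> sphere w 2" and y: "y \<in> equidistant {w, b} \<inter> sphere w 2"
  shows "x = y"
proof (rule ccontr)
  assume "x \<noteq> y"
  have ab: "a \<in> V" "d w a = 1" "b \<in> V" "d w b = 1"
    using nbrs by auto
  have dists: "d w z = 2" "d a z = 1" "d b z = 2" if z: "z \<in> equidistant {w, b} \<inter> sphere w 2" for z
  proof -
    show "d w z = 2" using z by simp
    show "d b z = 2" using z w ab dist_sym[of z w] dist_sym[of z b] by simp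
    then have "z \<notin> sphere b 1" by simp
    then have "z \<in> sphere a 1" using z degree_2_imp_sphere_2_eq[OF w nbrs] by blast
    then show "d a z = 1" by simp
  qed
  have "{w, a, b} \<subseteq> equidistant {x, y}"
    using dists[OF x] dists[OF y] w ab by simp
  then show False
    using not_three_equidistant[of x y w a b] x y \<open>x \<noteq> y\<close> w ab nbrs(2) by auto
qed

lemma degree_2_equidistant_neighbour_far:
  assumes w: "w \<in> V" and nbrs: "sphere w 1 = {a, b}" "a \<noteq> b"
  obtains z where "z \<in> outside w 3" "d z w = d z b"
proof -
  have ab: "a \<in> V" "d w a = 1" "b \<in> V" "d w b = 1"
    using nbrs by auto
  then have b: "b \<notin> sphere w 2" "b \<noteq> w" using w by auto
  obtain t where t: "equidistant {w, b} \<inter> sphere w 2 \<subseteq> {t}"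
    using degree_2_equidistant_neighbour_second_sphere_unique[OF assms] by blast
  obtain z where z: "z \<in> V" "d z w = d z b" "z \<noteq> t"
    using equidistant_neqE[of w b t] w ab b by metis
  have "b \<notin> sphere a 1" using degree_2_imp_sphere_2_eq[OF assms] b by blast
  then have "z \<noteq> a" using z w ab by (auto simp: dist_sym)
  moreover have "z \<noteq> w" "z \<noteq> b" using z w ab by (auto simp: dist_sym)
  ultimately have "d w z \<noteq> 0" "z \<notin> sphere w 1"
    using w z nbrs by auto
  moreover have "z \<notin> sphere w 2" using z t by auto
  ultimately have "z \<in> outside w 3" using z by simp
  then show thesis using that z by blast
qed

lemma degree_2_equidistant_neighbours_far:
  assumes w: "w \<in> V" and nbrs: "sphere w 1 = {a, b}" "a \<noteq> b"
  obtains z where "z \<in> outside w 3" "d z a = d z b"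
proof -
  have ab: "a \<in> V" "b \<in> V" using nbrs by auto
  obtain z where z: "z \<in> V" "d z a = d z b" "z \<noteq> w"
    using equidistant_neqE[of a b w] ab nbrs by auto
  have "z \<noteq> a" "z \<noteq> b" using z ab nbrs(2) by auto
  then have "d w z \<noteq> 0" "z \<notin> sphere w 1" using w z nbrs by auto
  moreover have "z \<notin> sphere w 2"
  proof
    assume "z \<in> sphere w 2"
    then have "z \<in> sphere a 1 \<inter> sphere b 1"
      using degree_2_imp_sphere_2_eq[OF assms] z ab by (auto simp: dist_sym)
    then show False using degree_2_imp_neighbourhoods_Int[OF assms] z by blast
  qed
  ultimately have "z \<in> outside w 3" using z by simp
  then show thesis using that z by blast
qed

lemma degree_2_imp_card_outside_3_ge_3:
  assumes w: "w \<in> V" and nbrs: "sphere w 1 = {a, b}" "a \<noteq> b"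
  shows "3 \<le> card (outside w 3)"
proof -
  obtain p where p: "p \<in> outside w 3" "d p w = d p a"
    using degree_2_equidistant_neighbour_far[of w b a] w nbrs by (metis insert_commute)
  obtain q where q: "q \<in> outside w 3" "d q w = d q b"
    using degree_2_equidistant_neighbour_far[OF assms] by blast
  obtain r where r: "r \<in> outside w 3" "d r a = d r b"
    using degree_2_equidistant_neighbours_far[OF assms] by blast
  have "d z a \<noteq> d z w \<or> d z b \<noteq> d z w" if z: "z \<in> outside w 3" for z
  proof -
    have "z \<in> V" "z \<noteq> w" using z w by auto
    then obtain u where "u \<in> sphere w 1" "d z w = Suc (d z u)"
      using neighbour_closer w by blast
    then show ?thesis using nbrs by auto
  qed
  then have "p \<noteq> q" "p \<noteq> r" "q \<noteq> r" using p q r by metis+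
  then have "card {p, q, r} = 3" by simp
  moreover have "card {p, q, r} \<le> card (outside w 3)"
    using p q r by (intro card_mono) auto
  ultimately show ?thesis by simp
qed

lemma degree_neq_2:
  assumes w: "w \<in> V"
  shows "card (sphere w 1) \<noteq> 2"
proof
  assume deg: "card (sphere w 1) = 2"
  then obtain a b where nbrs: "sphere w 1 = {a, b}" "a \<noteq> b" by (auto simp: card_2_iff)
  have card_sphere_2: "card (sphere w 2) = 4"
    using degree_2_imp_card_sphere_2_eq_4[OF w nbrs] .
  have "card V = 7 + card (outside w 3)"
    using card_verts_eq[OF w] card_outside[of w 2] deg card_sphere_2 by simp
  moreover have "card V \<le> 10"
    using order_le_10[OF _ degree_2_imp_neighbour_degree_eq_3[OF w nbrs]] nbrs(1) mem_sphere[of a w 1]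
    by simp
  moreover have "3 \<le> card (outside w 3)"
    using degree_2_imp_card_outside_3_ge_3[OF w nbrs] .
  ultimately have card_eq: "card V = 10" "card (outside w 3) = 3" by linarith+
  have "card (tied_pairs (d w) V) = 7 + card (tied_pairs (d w) (outside w 3))"
    using card_tied_pairs_verts_eq[OF w] card_tied_pairs_outside[of w 2] deg card_sphere_2
    by (simp add: choose_two)
  then have "card (tied_pairs (d w) (outside w 3)) = 2"
    using card_tied_pairs_dist[OF w] card_eq by simp
  then show False
    using card_tied_pairs_neq_2[OF card_eq(2)] by blast
qed

lemma degree_eq_3: "w \<in> V \<Longrightarrow> card (sphere w 1) = 3"
  using degree_ge_2[of w] degree_le_3[of w] degree_neq_2[of w] by linarith

end

theorem mainTheorem5:
  fixes G :: "('a, 'b) pre_digraph"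
  assumes "graph G"
    and "Digraph_Component.connected G"
    and "randomly_dimensional 3 G"
  shows "regular_graph 3 G"
proof -
  interpret randomly_3_dimensional_graph G
    using assms by (simp add: randomly_3_dimensional_graph_def randomly_3_dimensional_graph_axioms_def
        connected_graph_def connected_graph_axioms_def)
  show ?thesis
    by (simp add: regular_graph_def out_degree_eq_card_sphere degree_eq_3)
qed

end
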